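(* Let $W:\mathbb{R}\times\mathbb{R}^d\to\mathbb{R}^d$ be such that, for constants $\tau,\lambda\in(0,1]$, $\beta\ge0$, the seminorm $\|W\|_{\beta,\tau,\lambda;a,b}$ is finite for all $a<b$, and let $\varphi:\mathbb{R}\to\mathbb{R}^d$ satisfy, for some $\gamma\in(0,1]$, $\sup_{a\le s<t\le b}|\varphi_t-\varphi_s|/|t-s|^\gamma<\infty$ for all $a<b$. Assume $\tau+\lambda\gamma>1$ and let $T>0$. Then the symmetric integral $$\int_0^TW(\mathrm{d}^{\mathrm{sym}}s,\varphi_s)=\lim_{\epsilon\to0}\frac1{2\epsilon}\int_0^T\left(W(s+\epsilon,\varphi_s)-W(s-\epsilon,\varphi_s)\right)ds$$ exists and $$\int_0^TW(\mathrm{d}^{\mathrm{sym}}s,\varphi_s)=\int_0^TW(ds,\varphi_s),$$ where the right-hand side is the nonlinear Young integral.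
   Context: For $a<b$, $$\|W\|_{\beta,\tau,\lambda;a,b}=\sup_{\substack{a\le s<t\le b\\ x\ne y}}\frac{|W(s,x)-W(t,x)-W(s,y)+W(t,y)|}{(1+|x|+|y|)^\beta|t-s|^\tau|x-y|^\lambda}+\sup_{\substack{a\le s<t\le b\\ x\in\mathbb{R}^d}}\frac{|W(s,x)-W(t,x)|}{(1+|x|)^{\beta+\lambda}|t-s|^\tau}+\sup_{\substack{a\le t\le b\\ x\ne y}}\frac{|W(t,y)-W(t,x)|}{(1+|x|+|y|)^\beta|x-y|^\lambda}.$$ The nonlinear Young integral $\int_0^TW(ds,\varphi_s)$ is the limit, as the mesh of the partition $0=t_0<\dots<t_m=T$ tends to $0$, of $\sum_{i=0}^{m-1}[W(t_{i+1},\varphi_{t_i})-W(t_i,\varphi_{t_i})]$; it exists under the stated hypotheses. The symmetric integral is here taken pathwise, for a fixed function $W$. *)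

theory Defs
  imports "HOL-Analysis.Analysis"
begin

(* Extended-real-valued, so that "the seminorm is finite" is a genuine condition.  Every
   denominator below is positive on the range of its supremum. *)
definition W_seminorm ::
  "real \<Rightarrow> real \<Rightarrow> real \<Rightarrow> real \<Rightarrow> real \<Rightarrow> (real \<Rightarrow> real ^ 'd \<Rightarrow> real ^ 'd) \<Rightarrow> ennreal" where
  "W_seminorm \<beta> \<tau> lam a b W =
     (SUP (s, t, x, y) \<in> {(s, t, x, y). a \<le> s \<and> s < t \<and> t \<le> b \<and> x \<noteq> y}.
        ennreal (norm (W s x - W t x - W s y + W t y) /
          ((1 + norm x + norm y) powr \<beta> * \<bar>t - s\<bar> powr \<tau> * norm (x - y) powr lam)))
   + (SUP (s, t, x) \<in> {(s, t, x). a \<le> s \<and> s < t \<and> t \<le> b}.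
        ennreal (norm (W s x - W t x) /
          ((1 + norm x) powr (\<beta> + lam) * \<bar>t - s\<bar> powr \<tau>)))
   + (SUP (t, x, y) \<in> {(t, x, y). a \<le> t \<and> t \<le> b \<and> x \<noteq> y}.
        ennreal (norm (W t y - W t x) /
          ((1 + norm x + norm y) powr \<beta> * norm (x - y) powr lam)))"

definition holder_seminorm :: "real \<Rightarrow> real \<Rightarrow> real \<Rightarrow> (real \<Rightarrow> real ^ 'd) \<Rightarrow> ennreal" where
  "holder_seminorm \<gamma> a b \<phi> =
     (SUP (s, t) \<in> {(s, t). a \<le> s \<and> s < t \<and> t \<le> b}.
        ennreal (norm (\<phi> t - \<phi> s) / \<bar>t - s\<bar> powr \<gamma>))"

(* Only the values t 0, ..., t m matter. *)
definition is_partition :: "real \<Rightarrow> real \<Rightarrow> nat \<Rightarrow> (nat \<Rightarrow> real) \<Rightarrow> bool" where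
  "is_partition a b m t \<longleftrightarrow> t 0 = a \<and> t m = b \<and> (\<forall>i<m. t i < t (Suc i))"

definition has_young_integral ::
  "(real \<Rightarrow> real ^ 'd \<Rightarrow> real ^ 'd) \<Rightarrow> (real \<Rightarrow> real ^ 'd) \<Rightarrow> real \<Rightarrow> real \<Rightarrow> real ^ 'd \<Rightarrow> bool" where
  "has_young_integral W \<phi> a b I \<longleftrightarrow>
     (\<forall>e>0. \<exists>\<delta>>0. \<forall>m t. is_partition a b m t \<and> (\<forall>i<m. t (Suc i) - t i < \<delta>) \<longrightarrow>
        norm ((\<Sum>i<m. W (t (Suc i)) (\<phi> (t i)) - W (t i) (\<phi> (t i))) - I) < e)"

definition young_integrable ::
  "(real \<Rightarrow> real ^ 'd \<Rightarrow> real ^ 'd) \<Rightarrow> (real \<Rightarrow> real ^ 'd) \<Rightarrow> real \<Rightarrow> real \<Rightarrow> bool" where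
  "young_integrable W \<phi> a b \<longleftrightarrow> (\<exists>I. has_young_integral W \<phi> a b I)"

definition young_integral ::
  "(real \<Rightarrow> real ^ 'd \<Rightarrow> real ^ 'd) \<Rightarrow> (real \<Rightarrow> real ^ 'd) \<Rightarrow> real \<Rightarrow> real \<Rightarrow> real ^ 'd" where
  "young_integral W \<phi> a b = (THE I. has_young_integral W \<phi> a b I)"

(* The approximating expression is even in \<epsilon>, so the two-sided limit at 0 is the
   same as the limit for \<epsilon> decreasing to 0. *)
definition has_symmetric_integral ::
  "(real \<Rightarrow> real ^ 'd \<Rightarrow> real ^ 'd) \<Rightarrow> (real \<Rightarrow> real ^ 'd) \<Rightarrow> real \<Rightarrow> real \<Rightarrow> real ^ 'd \<Rightarrow> bool" where
  "has_symmetric_integral W \<phi> a b I \<longleftrightarrow>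
     (\<forall>\<^sub>F \<epsilon> in at 0. (\<lambda>s. W (s + \<epsilon>) (\<phi> s) - W (s - \<epsilon>) (\<phi> s)) integrable_on {a..b}) \<and>
     ((\<lambda>\<epsilon>. (1 / (2 * \<epsilon>)) *\<^sub>R
          integral {a..b} (\<lambda>s. W (s + \<epsilon>) (\<phi> s) - W (s - \<epsilon>) (\<phi> s))) \<longlongrightarrow> I) (at 0)"

definition symmetric_integrable ::
  "(real \<Rightarrow> real ^ 'd \<Rightarrow> real ^ 'd) \<Rightarrow> (real \<Rightarrow> real ^ 'd) \<Rightarrow> real \<Rightarrow> real \<Rightarrow> bool" where
  "symmetric_integrable W \<phi> a b \<longleftrightarrow> (\<exists>I. has_symmetric_integral W \<phi> a b I)"

definition symmetric_integral ::
  "(real \<Rightarrow> real ^ 'd \<Rightarrow> real ^ 'd) \<Rightarrow> (real \<Rightarrow> real ^ 'd) \<Rightarrow> real \<Rightarrow> real \<Rightarrow> real ^ 'd" where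
  "symmetric_integral W \<phi> a b = (THE I. has_symmetric_integral W \<phi> a b I)"

lemma ex_fine_partition:
  assumes "a < b" "\<delta> > 0"
  shows "\<exists>m t. is_partition a b m t \<and> (\<forall>i<m. t (Suc i) - t i < \<delta>)"
proof -
  obtain n :: nat where n: "(b - a) / \<delta> < real n"
    using reals_Archimedean2 by blast
  have pos: "0 < (b - a) / \<delta>" using assms by simp
  then have n0: "0 < real n" using n by linarith
  have step: "a + real (Suc i) * (b - a) / real n - (a + real i * (b - a) / real n)
      = (b - a) / real n" for i
    by (simp add: add_divide_distrib diff_divide_distrib algebra_simps)
  have small: "(b - a) / real n < \<delta>"
    using n n0 assms by (simp add: divide_simps mult.commute)
  have pos': "0 < (b - a) / real n" using n0 assms by simp
  have "is_partition a b n (\<lambda>i. a + real i * (b - a) / real n)"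
    unfolding is_partition_def
  proof (intro conjI allI impI)
    show "a + real i * (b - a) / real n < a + real (Suc i) * (b - a) / real n" for i
      using step[of i] pos' by linarith
  qed (use n0 in auto)
  then show ?thesis using step small by metis
qed

lemma has_young_integral_unique:
  assumes "a < b" "has_young_integral W \<phi> a b I" "has_young_integral W \<phi> a b J"
  shows "I = J"
proof (rule ccontr)
  assume "I \<noteq> J"
  define e where "e = norm (I - J) / 2"
  have "e > 0" using \<open>I \<noteq> J\<close> by (simp add: e_def)
  define S where "S = (\<lambda>m t. \<Sum>i<m. W (t (Suc i)) (\<phi> (t i)) - W (t i) (\<phi> (t i)))"
  obtain d1 where d1: "d1 > 0" "\<And>m t. is_partition a b m t \<Longrightarrow>
      \<forall>i<m. t (Suc i) - t i < d1 \<Longrightarrow> norm (S m t - I) < e"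
    using assms(2) \<open>e > 0\<close> unfolding has_young_integral_def S_def by meson
  obtain d2 where d2: "d2 > 0" "\<And>m t. is_partition a b m t \<Longrightarrow>
      \<forall>i<m. t (Suc i) - t i < d2 \<Longrightarrow> norm (S m t - J) < e"
    using assms(3) \<open>e > 0\<close> unfolding has_young_integral_def S_def by meson
  obtain m t where t: "is_partition a b m t" "\<forall>i<m. t (Suc i) - t i < min d1 d2"
    using ex_fine_partition[of a b "min d1 d2"] assms(1) d1(1) d2(1) by auto
  have "norm (S m t - I) < e" "norm (S m t - J) < e"
    using d1(2)[OF t(1)] d2(2)[OF t(1)] t(2) by simp_all
  moreover have "norm (I - J) \<le> norm (S m t - I) + norm (S m t - J)"
    using norm_triangle_ineq4[of "S m t - J" "S m t - I"] by simp
  ultimately show False by (simp add: e_def)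
qed

lemma has_symmetric_integral_unique:
  "has_symmetric_integral W \<phi> a b I \<Longrightarrow> has_symmetric_integral W \<phi> a b J \<Longrightarrow> I = J"
  unfolding has_symmetric_integral_def using tendsto_unique[OF at_neq_bot] by blast

end

theory Submission
  imports Defs
begin

text \<open>With \<open>A s t = W t (\<phi> s) - W s (\<phi> s)\<close> and \<open>\<theta> = \<tau> + lam * \<gamma>\<close>, the defect
  \<open>A s t - A s u - A u t\<close> is \<open>O(\<bar>t - s\<bar> powr \<theta>)\<close> with \<open>\<theta> > 1\<close>, so the sewing lemma gives a function
  \<open>J\<close> with \<open>J t - J s = A s t + O(\<bar>t - s\<bar> powr \<theta>)\<close>. Riemann sums of \<open>A\<close> therefore converge to
  \<open>J T - J 0\<close>. For the symmetric integral, \<open>W (s + \<epsilon>) (\<phi> s) - W (s - \<epsilon>) (\<phi> s)\<close> equals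
  \<open>J (s + \<epsilon>) - J (s - \<epsilon>)\<close> up to \<open>O(\<epsilon> powr \<theta>)\<close>, and integrating the latter over \<open>[0, T]\<close> leaves only
  averages of the continuous function \<open>J\<close> near the two endpoints.\<close>

section \<open>Sewing along finite point sets, then on an interval\<close>

text \<open>The constant \<open>2 * C / (1 - 2 powr (1 - \<theta>))\<close> is the fixed point of
  the recursion that bisection produces: the two remaining pieces together cost a factor
  \<open>2 powr (1 - \<theta>)\<close>, which is below 1 since \<open>\<theta> > 1\<close>, and each
  split adds \<open>2 * C\<close>. Neither the number nor the spacing of the points enters; the
  later compactness argument relies on this uniformity.\<close>

lemma sewing_sum_bound:
  fixes A :: "real \<Rightarrow> real \<Rightarrow> 'v::real_normed_vector" and x :: "nat \<Rightarrow> real"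
  assumes "1 < \<theta>" "0 \<le> C"
    and delta: "\<And>s u t. a \<le> s \<Longrightarrow> s \<le> u \<Longrightarrow> u \<le> t \<Longrightarrow> t \<le> b \<Longrightarrow>
      norm (A s t - A s u - A u t) \<le> C * (t - s) powr \<theta>"
    and mono: "\<And>i j. i \<le> j \<Longrightarrow> j \<le> n \<Longrightarrow> x i \<le> x j"
    and ab: "\<And>i. i \<le> n \<Longrightarrow> x i \<in> {a..b}"
    and "p \<le> q" "q \<le> n"
  shows "norm ((\<Sum>i=p..<q. A (x i) (x (Suc i))) - A (x p) (x q))
    \<le> 2 * C / (1 - 2 powr (1 - \<theta>)) * (x q - x p) powr \<theta>"
  using \<open>p \<le> q\<close> \<open>q \<le> n\<close>
proof (induction "q - p" arbitrary: p q rule: less_induct)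
  case less
  define K where "K = 2 * C / (1 - 2 powr (1 - \<theta>))"
  have "2 powr (1 - \<theta>) < (2::real) powr 0"
    by (rule powr_less_mono) (use \<open>1 < \<theta>\<close> in auto)
  then have lt1: "2 powr (1 - \<theta>) < (1::real)" by simp
  then have K0: "0 \<le> K" using \<open>0 \<le> C\<close> by (simp add: K_def)
  define S where "S = (\<lambda>p q. \<Sum>i=p..<q. A (x i) (x (Suc i)))"
  show ?case
  proof (cases "p = q")
    case True
    \<comment> \<open>Taking \<open>s = u = t\<close> in \<open>delta\<close> forces
      \<open>A (x p) (x p) = 0\<close>, because \<open>0 powr \<theta> = 0\<close>; so the empty sum
      has no error.\<close>
    have "norm (A (x p) (x p) - A (x p) (x p) - A (x p) (x p)) \<le> C * (x p - x p) powr \<theta>"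
      using ab[of p] less.prems by (intro delta) auto
    then show ?thesis using True by simp
  next
    case False
    then have "p < q" using less.prems by simp
    define L where "L = x q - x p"
    have L0: "0 \<le> L" using mono[of p q] less.prems by (simp add: L_def)
    \<comment> \<open>Drop the interval containing the midpoint: what remains on either side has length at most
      \<open>L / 2\<close>, so the two inductive bounds add up to at most \<open>2 powr (1 - \<theta>)\<close> times the claimed one.\<close>
    define I where "I = {i. p \<le> i \<and> i < q \<and> x i \<le> x p + L / 2}"
    have "finite I" "p \<in> I" using \<open>p < q\<close> L0 by (auto simp: I_def)
    then obtain i where i: "i \<in> I" and imax: "\<And>j. j \<in> I \<Longrightarrow> j \<le> i"
      using Max_in[of I] Max_ge[of I] by (metis empty_iff)
    have pi: "p \<le> i" "i < q" "x i \<le> x p + L / 2" using i by (auto simp: I_def)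
    have "x q - x (Suc i) \<le> L / 2"
    proof (cases "Suc i = q")
      case False
      then have "\<not> x (Suc i) \<le> x p + L / 2" using imax[of "Suc i"] pi by (auto simp: I_def)
      then show ?thesis by (simp add: L_def field_simps)
    qed (use L0 in simp)
    have iq: "Suc i \<le> q" "i \<le> n" "Suc i \<le> n" "p \<le> n" using pi less.prems by auto
    have m: "x p \<le> x i" "x i \<le> x (Suc i)" "x (Suc i) \<le> x q"
      using mono[of p i] mono[of i "Suc i"] mono[of "Suc i" q] pi iq less.prems by auto
    have split: "S p q = S p i + A (x i) (x (Suc i)) + S (Suc i) q"
    proof -
      have "S p q = S p i + S i q"
        unfolding S_def using pi by (simp add: sum.atLeastLessThan_concat)
      moreover have "S i q = A (x i) (x (Suc i)) + S (Suc i) q"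
        unfolding S_def using pi by (simp add: sum.atLeast_Suc_lessThan)
      ultimately show ?thesis by (simp add: algebra_simps)
    qed
    have half: "K * y powr \<theta> \<le> K * (L / 2) powr \<theta>" if "0 \<le> y" "y \<le> L / 2" for y
      using that K0 \<open>1 < \<theta>\<close> by (intro mult_left_mono powr_mono2) auto
    have l: "norm (S p i - A (x p) (x i)) \<le> K * (L / 2) powr \<theta>"
      using less.hyps[of i p] half[of "x i - x p"] pi iq m unfolding S_def K_def by force
    have r: "norm (S (Suc i) q - A (x (Suc i)) (x q)) \<le> K * (L / 2) powr \<theta>"
      using less.hyps[of q "Suc i"] half[of "x q - x (Suc i)"] pi iq m less.prems
        \<open>x q - x (Suc i) \<le> L / 2\<close> unfolding S_def K_def by force
    \<comment> \<open>Two defects arise because the dropped interval has two endpoints: the whole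
      range is cut at \<open>x i\<close>, and what lies to the right of it is cut again at
      \<open>x (Suc i)\<close>.\<close>
    have d1: "norm (A (x p) (x q) - A (x p) (x i) - A (x i) (x q)) \<le> C * L powr \<theta>"
      unfolding L_def using ab[of p] ab[of q] iq less.prems m by (intro delta) auto
    have "norm (A (x i) (x q) - A (x i) (x (Suc i)) - A (x (Suc i)) (x q)) \<le> C * (x q - x i) powr \<theta>"
      using ab[of i] ab[of q] iq less.prems m by (intro delta) auto
    also have "\<dots> \<le> C * L powr \<theta>"
      unfolding L_def using m \<open>0 \<le> C\<close> \<open>1 < \<theta>\<close> by (intro mult_left_mono powr_mono2) auto
    finally have d2: "norm (A (x i) (x q) - A (x i) (x (Suc i)) - A (x (Suc i)) (x q)) \<le> C * L powr \<theta>" .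
    have "S p q - A (x p) (x q) = (S p i - A (x p) (x i)) + (S (Suc i) q - A (x (Suc i)) (x q))
       - (A (x p) (x q) - A (x p) (x i) - A (x i) (x q))
       - (A (x i) (x q) - A (x i) (x (Suc i)) - A (x (Suc i)) (x q))"
      unfolding split by (simp add: algebra_simps)
    then have "norm (S p q - A (x p) (x q)) \<le>
       K * (L / 2) powr \<theta> + K * (L / 2) powr \<theta> + C * L powr \<theta> + C * L powr \<theta>"
      using l r d1 d2 by (smt (verit) norm_triangle_ineq norm_triangle_ineq4)
    also have "\<dots> = (K * 2 powr (1 - \<theta>) + 2 * C) * L powr \<theta>"
      using L0 by (simp add: powr_divide powr_diff algebra_simps)
    also have "K * 2 powr (1 - \<theta>) + 2 * C = K"
    proof -
      have "K * (1 - 2 powr (1 - \<theta>)) = 2 * C" using lt1 \<open>1 < \<theta>\<close> by (simp add: K_def)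
      then show ?thesis by (simp add: right_diff_distrib)
    qed
    finally show ?thesis unfolding S_def K_def L_def .
  qed
qed

text \<open>On a finite set the primitive is explicit: the running sum of \<open>A\<close> over
  consecutive points in increasing order. Its increments are exactly the sums estimated in
  \<open>sewing_sum_bound\<close>, so the constant does not depend on \<open>F\<close>.\<close>

lemma sewing_finite:
  fixes A :: "real \<Rightarrow> real \<Rightarrow> 'v::real_normed_vector"
  assumes "1 < \<theta>" "0 \<le> C"
    and delta: "\<And>s u t. a \<le> s \<Longrightarrow> s \<le> u \<Longrightarrow> u \<le> t \<Longrightarrow> t \<le> b \<Longrightarrow>
      norm (A s t - A s u - A u t) \<le> C * (t - s) powr \<theta>"
    and "finite F" "F \<subseteq> {a..b}" "a \<in> F"
  shows "\<exists>J. J a = 0 \<and> (\<forall>s\<in>F. \<forall>t\<in>F. s \<le> t \<longrightarrow>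
    norm (J t - J s - A s t) \<le> 2 * C / (1 - 2 powr (1 - \<theta>)) * (t - s) powr \<theta>)"
proof -
  define xs where "xs = sorted_list_of_set F"
  have xs: "set xs = F" "sorted xs" "distinct xs" using \<open>finite F\<close> by (auto simp: xs_def)
  define n where "n = length xs - 1"
  have len: "length xs = Suc n" using xs \<open>a \<in> F\<close> unfolding n_def by (cases xs) auto
  define x where "x = (\<lambda>i. xs ! i)"
  have inj: "inj_on x {..n}"
    using xs len unfolding x_def inj_on_def by (auto simp: nth_eq_iff_index_eq)
  \<comment> \<open>The inverse of \<open>x\<close> recovers the position of a point in the list;
    only values of \<open>J\<close> on \<open>F\<close> carry meaning.\<close>
  define J where "J = (\<lambda>t. \<Sum>i=0..<the_inv_into {..n} x t. A (x i) (x (Suc i)))"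
  have J: "J (x k) = (\<Sum>i=0..<k. A (x i) (x (Suc i)))" if "k \<le> n" for k
    unfolding J_def using the_inv_into_f_f[OF inj, of k] that by simp
  have F: "\<exists>k\<le>n. t = x k" if "t \<in> F" for t
    using that xs len unfolding x_def by (metis in_set_conv_nth less_Suc_eq_le)
  have xF: "x k \<in> F" if "k \<le> n" for k
    using that xs len unfolding x_def by auto
  have mono: "x i \<le> x j" if "i \<le> j" "j \<le> n" for i j
    using that xs len unfolding x_def by (auto intro: sorted_nth_mono)
  have "x 0 = a"
    using F[OF \<open>a \<in> F\<close>] mono[of 0] xF[of 0] \<open>F \<subseteq> {a..b}\<close> by fastforce
  then have J0: "J a = 0" using J[of 0] by simp
  have "norm (J t - J s - A s t) \<le> 2 * C / (1 - 2 powr (1 - \<theta>)) * (t - s) powr \<theta>"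
    if "s \<in> F" "t \<in> F" "s \<le> t" for s t
  proof -
    obtain p q where pq: "p \<le> n" "s = x p" "q \<le> n" "t = x q" using F[OF \<open>s \<in> F\<close>] F[OF \<open>t \<in> F\<close>] by blast
    show ?thesis
    proof (cases "p \<le> q")
      case True
      have "J t = J s + (\<Sum>i=p..<q. A (x i) (x (Suc i)))"
        using True pq by (simp add: J sum.atLeastLessThan_concat)
      then have "J t - J s - A s t = (\<Sum>i=p..<q. A (x i) (x (Suc i))) - A (x p) (x q)"
        using pq by simp
      moreover have "norm ((\<Sum>i=p..<q. A (x i) (x (Suc i))) - A (x p) (x q))
          \<le> 2 * C / (1 - 2 powr (1 - \<theta>)) * (x q - x p) powr \<theta>"
        by (rule sewing_sum_bound[OF assms(1-3), where n = n])
          (use mono xF \<open>F \<subseteq> {a..b}\<close> True pq in blast)+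
      ultimately show ?thesis using pq by simp
    next
      case False
      \<comment> \<open>The order of indices contradicts \<open>s \<le> t\<close> unless the points
        coincide, and then the claim reduces to \<open>A t t = 0\<close>, again by
        \<open>delta\<close>.\<close>
      then have "s = t" using mono[of q p] pq that by simp
      moreover have "norm (A t t - A t t - A t t) \<le> C * (t - t) powr \<theta>"
        using that \<open>F \<subseteq> {a..b}\<close> by (intro delta) auto
      ultimately show ?thesis by simp
    qed
  qed
  with J0 show ?thesis by blast
qed

text \<open>The finite sums over sorted point sets satisfy finitely many of the required closed conditions
  each, so Tychonoff's theorem yields a function satisfying all of them; no limit of Riemann sums
  has to be shown to exist.\<close>

lemma sewing:
  fixes A :: "real \<Rightarrow> real \<Rightarrow> 'v::euclidean_space"
  assumes "1 < \<theta>" "0 \<le> C" "a \<le> b"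
    and delta: "\<And>s u t. a \<le> s \<Longrightarrow> s \<le> u \<Longrightarrow> u \<le> t \<Longrightarrow> t \<le> b \<Longrightarrow>
      norm (A s t - A s u - A u t) \<le> C * (t - s) powr \<theta>"
  shows "\<exists>J. \<exists>K\<ge>0. \<forall>s t. a \<le> s \<longrightarrow> s \<le> t \<longrightarrow> t \<le> b \<longrightarrow>
    norm (J t - J s - A s t) \<le> K * (t - s) powr \<theta>"
proof -
  define K where "K = 2 * C / (1 - 2 powr (1 - \<theta>))"
  have "2 powr (1 - \<theta>) < (2::real) powr 0"
    by (rule powr_less_mono) (use \<open>1 < \<theta>\<close> in auto)
  then have K0: "0 \<le> K" using \<open>0 \<le> C\<close> by (simp add: K_def)
  \<comment> \<open>With \<open>J a = 0\<close>, the condition for the pair \<open>(a, t)\<close>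
    confines \<open>J t\<close> to a closed ball around \<open>A a t\<close>, compact in a Euclidean
    space. Coordinates outside \<open>{a..b}\<close> are pinned to 0, so that the full product is
    compact.\<close>
  define B where "B = (\<lambda>t. if t \<in> {a..b} then cball (A a t) (K * (t - a) powr \<theta>) else {0})"
  define X where "X = Pi\<^sub>E UNIV B"
  define Q where "Q = (\<lambda>(s, t). {J. norm (J t - J s - A s t) \<le> K * (t - s) powr \<theta>})"
  define I where "I = {(s, t). a \<le> s \<and> s \<le> t \<and> t \<le> b}"
  have "compactin (product_topology (\<lambda>i. euclidean) UNIV) X"
    unfolding X_def compactin_PiE by (auto simp: B_def)
  then have "compact X" by (simp add: euclidean_product_topology)
  \<comment> \<open>Each condition involves only two coordinates, and coordinate projections are
    continuous for the product topology.\<close>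
  moreover have "closed (Q z)" if "z \<in> I" for z
    unfolding Q_def case_prod_beta
    by (intro closed_Collect_le continuous_intros continuous_on_product_coordinates)
  moreover have "X \<inter> (\<Inter>z\<in>I'. Q z) \<noteq> {}" if I': "finite I'" "I' \<subseteq> I" for I'
  proof -
    define F where "F = insert a (fst ` I' \<union> snd ` I')"
    have F: "finite F" "F \<subseteq> {a..b}" "a \<in> F" using I' \<open>a \<le> b\<close> by (auto simp: F_def I_def)
    obtain J where J: "J a = 0" "\<And>s t. s \<in> F \<Longrightarrow> t \<in> F \<Longrightarrow> s \<le> t \<Longrightarrow>
        norm (J t - J s - A s t) \<le> K * (t - s) powr \<theta>"
      using sewing_finite[OF assms(1,2,4) F, folded K_def] by blast
    \<comment> \<open>Off \<open>F\<close> the function takes the centre of its ball, so it stays in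
      \<open>X\<close> without affecting the finitely many conditions in \<open>I'\<close>, whose
      endpoints all lie in \<open>F\<close>.\<close>
    define J' where "J' = (\<lambda>t. if t \<in> F then J t else if t \<in> {a..b} then A a t else 0)"
    have "J' t \<in> B t" for t
    proof (cases "t \<in> F")
      case True
      then have "a \<le> t" "t \<le> b" using F(2) by auto
      then show ?thesis using J(1) J(2)[OF F(3) True]
        by (simp add: B_def J'_def True dist_norm norm_minus_commute)
    qed (use K0 in \<open>simp add: B_def J'_def\<close>)
    then have "J' \<in> X" by (auto simp: X_def PiE_iff)
    moreover have "J' \<in> Q z" if "z \<in> I'" for z
    proof -
      have "fst z \<in> F" "snd z \<in> F" "fst z \<le> snd z" using that I' by (auto simp: F_def I_def)
      then show ?thesis using J(2) by (simp add: Q_def J'_def case_prod_beta)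
    qed
    ultimately show ?thesis by blast
  qed
  ultimately have "X \<inter> (\<Inter>z\<in>I. Q z) \<noteq> {}" by (rule compact_imp_fip_image)
  then obtain J where "\<And>z. z \<in> I \<Longrightarrow> J \<in> Q z" by blast
  then have "norm (J t - J s - A s t) \<le> K * (t - s) powr \<theta>" if "a \<le> s" "s \<le> t" "t \<le> b" for s t
    using that unfolding I_def Q_def by force
  with K0 show ?thesis by blast
qed

section \<open>Convergence of the Young sums\<close>

text \<open>Increments of \<open>J\<close> telescope, so the error of a sum is the total of the
  local errors. A step of length \<open>d < \<delta>\<close> contributes at most
  \<open>K * d * \<delta> powr (\<theta> - 1)\<close>, and the lengths add up to
  \<open>b - a\<close>.\<close>

lemma has_young_integral_of_sewing:
  assumes "1 < \<theta>" "0 \<le> K" "a \<le> b"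
    and sew: "\<And>s t. a \<le> s \<Longrightarrow> s \<le> t \<Longrightarrow> t \<le> b \<Longrightarrow>
      norm (J t - J s - (W t (\<phi> s) - W s (\<phi> s))) \<le> K * (t - s) powr \<theta>"
  shows "has_young_integral W \<phi> a b (J b - J a)"
  unfolding has_young_integral_def
proof (intro allI impI)
  fix e :: real assume "0 < e"
  define M where "M = K * (b - a)"
  have "0 \<le> M" using assms by (simp add: M_def)
  \<comment> \<open>Chosen so that \<open>\<delta> powr (\<theta> - 1) = e / (M + 1)\<close>; the
    summand 1 covers \<open>M = 0\<close> and makes the final bound strictly smaller than
    \<open>e\<close>.\<close>
  define \<delta> where "\<delta> = (e / (M + 1)) powr (1 / (\<theta> - 1))"
  have \<delta>: "0 < \<delta>" "\<delta> powr (\<theta> - 1) = e / (M + 1)"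
    using \<open>0 < e\<close> \<open>0 \<le> M\<close> \<open>1 < \<theta>\<close> by (simp_all add: \<delta>_def powr_powr)
  show "\<exists>\<delta>>0. \<forall>m t. is_partition a b m t \<and> (\<forall>i<m. t (Suc i) - t i < \<delta>) \<longrightarrow>
        norm ((\<Sum>i<m. W (t (Suc i)) (\<phi> (t i)) - W (t i) (\<phi> (t i))) - (J b - J a)) < e"
  proof (intro exI[of _ \<delta>] conjI allI impI)
    fix m t assume *: "is_partition a b m t \<and> (\<forall>i<m. t (Suc i) - t i < \<delta>)"
    then have t: "t 0 = a" "t m = b" "\<And>i. i < m \<Longrightarrow> t i < t (Suc i)"
      "\<And>i. i < m \<Longrightarrow> t (Suc i) - t i < \<delta>"
      by (auto simp: is_partition_def)
    have lo: "a \<le> t i" if "i \<le> m" for i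
      using that
    proof (induction i)
      case (Suc i) then show ?case using t(3)[of i] by simp
    qed (use t in simp)
    have hi: "t i \<le> b" if "i \<le> m" for i
      using that
    proof (induction rule: inc_induct)
      case (step i) then show ?case using t(3)[of i] by simp
    qed (use t in simp)
    define E where "E = (\<lambda>i. J (t (Suc i)) - J (t i) - (W (t (Suc i)) (\<phi> (t i)) - W (t i) (\<phi> (t i))))"
    have E: "norm (E i) \<le> K * (t (Suc i) - t i) * \<delta> powr (\<theta> - 1)" if "i < m" for i
    proof -
      define d where "d = t (Suc i) - t i"
      have d: "0 < d" "d < \<delta>" using t that by (auto simp: d_def)
      have "norm (E i) \<le> K * d powr \<theta>"
        unfolding E_def d_def using sew[of "t i" "t (Suc i)"] lo[of i] hi[of "Suc i"] t(3)[OF that] that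
        by simp
      also have "d powr \<theta> = d * d powr (\<theta> - 1)" using d by (simp add: powr_diff)
      also have "K * (d * d powr (\<theta> - 1)) \<le> K * (d * \<delta> powr (\<theta> - 1))"
        using d \<open>0 \<le> K\<close> \<open>1 < \<theta>\<close> by (intro mult_left_mono powr_mono2) auto
      finally show ?thesis by (simp add: d_def)
    qed
    have "(\<Sum>i<m. W (t (Suc i)) (\<phi> (t i)) - W (t i) (\<phi> (t i))) - (J b - J a) = - (\<Sum>i<m. E i)"
      using sum_lessThan_telescope[of "\<lambda>i. J (t i)" m] t by (simp add: E_def sum_subtractf)
    then have "norm ((\<Sum>i<m. W (t (Suc i)) (\<phi> (t i)) - W (t i) (\<phi> (t i))) - (J b - J a))
        \<le> (\<Sum>i<m. K * (t (Suc i) - t i) * \<delta> powr (\<theta> - 1))"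
      using E by (auto intro!: sum_norm_le)
    also have "\<dots> = K * (\<Sum>i<m. t (Suc i) - t i) * \<delta> powr (\<theta> - 1)"
      by (simp add: sum_distrib_left sum_distrib_right)
    also have "\<dots> = M * (e / (M + 1))"
      using sum_lessThan_telescope[of t m] t \<delta> by (simp add: M_def)
    also have "\<dots> < e" using \<open>0 < e\<close> \<open>0 \<le> M\<close> by (simp add: field_simps)
    finally show "norm ((\<Sum>i<m. W (t (Suc i)) (\<phi> (t i)) - W (t i) (\<phi> (t i))) - (J b - J a)) < e" .
  qed (use \<delta> in simp)
qed

section \<open>Symmetric difference quotients and the symmetric integral\<close>

text \<open>The symmetric quotient is the average of the ordinary quotients \<open>q h\<close> and
  \<open>q (- h)\<close>, and both tend to \<open>D\<close>.\<close>

lemma symmetric_difference_quotient_tendsto: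
  fixes F :: "real \<Rightarrow> 'v::real_normed_vector"
  assumes "(F has_vector_derivative D) (at c)"
  shows "((\<lambda>\<epsilon>. (1 / (2 * \<epsilon>)) *\<^sub>R (F (c + \<epsilon>) - F (c - \<epsilon>))) \<longlongrightarrow> D) (at 0)"
proof -
  define q where "q = (\<lambda>h. (1 / h) *\<^sub>R (F (c + h) - F c))"
  have "((\<lambda>h. norm (F (c + h) - F c - h *\<^sub>R D) / norm h) \<longlongrightarrow> 0) (at 0)"
    using assms unfolding has_vector_derivative_def has_derivative_at by blast
  moreover have "\<forall>\<^sub>F h in at 0. norm (F (c + h) - F c - h *\<^sub>R D) / norm h = norm (q h - D)"
    unfolding eventually_at_filter
  proof (intro always_eventually allI impI)
    fix h :: real assume "h \<noteq> 0"
    then have "q h - D = (1 / h) *\<^sub>R (F (c + h) - F c - h *\<^sub>R D)"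
      by (simp add: q_def scaleR_diff_right)
    then show "norm (F (c + h) - F c - h *\<^sub>R D) / norm h = norm (q h - D)" by simp
  qed
  ultimately have "((\<lambda>h. norm (q h - D)) \<longlongrightarrow> 0) (at 0)" by (rule Lim_transform_eventually)
  then have q: "(q \<longlongrightarrow> D) (at 0)" by (rule LIM_zero_cancel[OF tendsto_norm_zero_cancel])
  have "filterlim uminus (at 0) (at (0::real))"
    by (rule filterlim_atI) (auto intro!: tendsto_eq_intros simp: eventually_at_filter)
  with q have "((\<lambda>h. q (- h)) \<longlongrightarrow> D) (at 0)" by (rule filterlim_compose)
  then have "((\<lambda>h. (1 / 2) *\<^sub>R (q h + q (- h))) \<longlongrightarrow> (1 / 2) *\<^sub>R (D + D)) (at 0)"
    using q by (intro tendsto_intros)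
  moreover have "(1 / 2) *\<^sub>R (q h + q (- h)) = (1 / (2 * h)) *\<^sub>R (F (c + h) - F (c - h))" for h
    by (simp add: q_def scaleR_diff_right scaleR_add_right)
  ultimately show ?thesis by (simp flip: scaleR_2)
qed

text \<open>Replacing \<open>W\<close> by \<open>J\<close> costs
  \<open>O(\<bar>\<epsilon>\<bar> powr (\<theta> - 1))\<close> after division by
  \<open>2 * \<epsilon>\<close>, which vanishes in the limit. For \<open>J\<close> itself the
  integral becomes a difference of two symmetric quotients of its primitive, taken at
  \<open>b\<close> and at \<open>a\<close>.\<close>

lemma has_symmetric_integral_of_approx:
  assumes "1 < \<theta>" "a < b"
    and J: "continuous_on {a - 1..b + 1} J"
    and cont: "\<And>\<epsilon>. \<bar>\<epsilon>\<bar> < 1 \<Longrightarrow> continuous_on {a..b} (\<lambda>s. W (s + \<epsilon>) (\<phi> s))"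
    and near: "\<And>\<epsilon> s. 0 < \<epsilon> \<Longrightarrow> \<epsilon> < 1 \<Longrightarrow> s \<in> {a..b} \<Longrightarrow>
      norm (W (s + \<epsilon>) (\<phi> s) - W (s - \<epsilon>) (\<phi> s) - (J (s + \<epsilon>) - J (s - \<epsilon>))) \<le> D * \<epsilon> powr \<theta>"
  shows "has_symmetric_integral W \<phi> a b (J b - J a)"
proof -
  define w where "w = (\<lambda>\<epsilon> s. W (s + \<epsilon>) (\<phi> s) - W (s - \<epsilon>) (\<phi> s))"
  define j where "j = (\<lambda>\<epsilon> s. J (s + \<epsilon>) - J (s - \<epsilon>))"
  \<comment> \<open>Starting the primitive at \<open>a - 1\<close> makes both \<open>a\<close> and
    \<open>b\<close> interior points, where it has a two-sided derivative.\<close>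
  define F where "F = (\<lambda>x. integral {a - 1..x} J)"
  have ev: "\<forall>\<^sub>F \<epsilon> in at 0. \<epsilon> \<noteq> 0 \<and> \<bar>\<epsilon>\<bar> < (1::real)"
    unfolding eventually_at by (rule exI[of _ 1]) (auto simp: dist_norm)
  have cw: "continuous_on {a..b} (w \<epsilon>)" if "\<bar>\<epsilon>\<bar> < 1" for \<epsilon>
    using continuous_on_diff[OF cont[of \<epsilon>] cont[of "-\<epsilon>"]] that by (simp add: w_def)
  have cJ: "continuous_on {a..b} (\<lambda>s. J (s + \<epsilon>))" if "\<bar>\<epsilon>\<bar> < 1" for \<epsilon>
    by (rule continuous_on_compose2[OF J]) (use that in \<open>auto intro!: continuous_intros\<close>)
  have cj: "continuous_on {a..b} (j \<epsilon>)" if "\<bar>\<epsilon>\<bar> < 1" for \<epsilon>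
    using continuous_on_diff[OF cJ[of \<epsilon>] cJ[of "-\<epsilon>"]] that by (simp add: j_def)
  \<comment> \<open>The limit is two-sided while \<open>near\<close> covers positive parameters
    only; \<open>w\<close> and \<open>j\<close> are odd in \<open>\<epsilon>\<close>, which settles
    negative ones.\<close>
  have near': "norm (w \<epsilon> s - j \<epsilon> s) \<le> D * \<bar>\<epsilon>\<bar> powr \<theta>" if "\<epsilon> \<noteq> 0" "\<bar>\<epsilon>\<bar> < 1" "s \<in> {a..b}" for \<epsilon> s
  proof (cases "0 < \<epsilon>")
    case True
    then show ?thesis using near[of \<epsilon> s] that by (simp add: w_def j_def)
  next
    case False
    then have "norm (w (-\<epsilon>) s - j (-\<epsilon>) s) \<le> D * \<bar>\<epsilon>\<bar> powr \<theta>"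
      using near[of "-\<epsilon>" s] that by (simp add: w_def j_def)
    moreover have "w \<epsilon> s - j \<epsilon> s = - (w (-\<epsilon>) s - j (-\<epsilon>) s)" by (simp add: w_def j_def)
    ultimately show ?thesis by (simp only: norm_minus_cancel)
  qed
  have shift: "integral {a..b} (\<lambda>s. J (s + \<epsilon>)) = F (b + \<epsilon>) - F (a + \<epsilon>)" if "\<bar>\<epsilon>\<bar> < 1" for \<epsilon>
  proof -
    have "integral {a..b} (\<lambda>s. J (s + \<epsilon>)) = integral {a + \<epsilon>..b + \<epsilon>} J"
      using integral_shift_real_ivl[of "a + \<epsilon>" \<epsilon> "b + \<epsilon>" J] by simp
    moreover have "F (a + \<epsilon>) + integral {a + \<epsilon>..b + \<epsilon>} J = F (b + \<epsilon>)"
      unfolding F_def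
    proof (rule Henstock_Kurzweil_Integration.integral_combine)
      show "J integrable_on {a - 1..b + \<epsilon>}"
        by (rule integrable_continuous_real, rule continuous_on_subset[OF J]) (use that in auto)
    qed (use that \<open>a < b\<close> in auto)
    ultimately show ?thesis by (simp add: algebra_simps)
  qed
  \<comment> \<open>The four values of \<open>F\<close> are grouped by endpoint rather than by the
    sign of the shift, which exposes the two symmetric differences.\<close>
  have intj: "integral {a..b} (j \<epsilon>) = (F (b + \<epsilon>) - F (b - \<epsilon>)) - (F (a + \<epsilon>) - F (a - \<epsilon>))"
    if "\<bar>\<epsilon>\<bar> < 1" for \<epsilon>
  proof -
    have "integral {a..b} (j \<epsilon>) = integral {a..b} (\<lambda>s. J (s + \<epsilon>)) - integral {a..b} (\<lambda>s. J (s + - \<epsilon>))"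
      unfolding j_def diff_conv_add_uminus[of _ \<epsilon>]
      by (intro integral_diff integrable_continuous_real cJ) (use that in auto)
    then show ?thesis using shift[of \<epsilon>] shift[of "-\<epsilon>"] that by simp
  qed
  have Fderiv: "(F has_vector_derivative J c) (at c)" if "c \<in> {a..b}" for c
    using integral_has_vector_derivative[OF J, of c] at_within_Icc_at[of "a - 1" c "b + 1"] that
    by (simp add: F_def)
  have "((\<lambda>\<epsilon>. (1 / (2 * \<epsilon>)) *\<^sub>R (F (b + \<epsilon>) - F (b - \<epsilon>))
        - (1 / (2 * \<epsilon>)) *\<^sub>R (F (a + \<epsilon>) - F (a - \<epsilon>))) \<longlongrightarrow> J b - J a) (at 0)"
    by (intro tendsto_diff symmetric_difference_quotient_tendsto Fderiv) (use \<open>a < b\<close> in auto)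
  then have main: "((\<lambda>\<epsilon>. (1 / (2 * \<epsilon>)) *\<^sub>R integral {a..b} (j \<epsilon>)) \<longlongrightarrow> J b - J a) (at 0)"
    by (rule Lim_transform_eventually)
      (use ev in \<open>eventually_elim, simp add: intj scaleR_diff_right\<close>)
  have "((\<lambda>\<epsilon>. D * (b - a) / 2 * \<bar>\<epsilon>\<bar> powr (\<theta> - 1)) \<longlongrightarrow> D * (b - a) / 2 * \<bar>0\<bar> powr (\<theta> - 1)) (at 0)"
    using \<open>1 < \<theta>\<close> by (intro tendsto_intros tendsto_powr') auto
  then have "((\<lambda>\<epsilon>. D * (b - a) / 2 * \<bar>\<epsilon>\<bar> powr (\<theta> - 1)) \<longlongrightarrow> 0) (at 0)" by simp
  moreover have "\<forall>\<^sub>F \<epsilon> in at 0. norm ((1 / (2 * \<epsilon>)) *\<^sub>R integral {a..b} (w \<epsilon>) - (1 / (2 * \<epsilon>)) *\<^sub>R integral {a..b} (j \<epsilon>))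
      \<le> D * (b - a) / 2 * \<bar>\<epsilon>\<bar> powr (\<theta> - 1)"
    using ev
  proof eventually_elim
    case (elim \<epsilon>)
    have "integral {a..b} (w \<epsilon>) - integral {a..b} (j \<epsilon>) = integral {a..b} (\<lambda>s. w \<epsilon> s - j \<epsilon> s)"
      using elim by (intro integral_diff[symmetric] integrable_continuous_real cw cj) auto
    also have "norm \<dots> \<le> (D * \<bar>\<epsilon>\<bar> powr \<theta>) * (b - a)"
      using elim \<open>a < b\<close> by (intro integral_bound continuous_on_diff cw cj near') auto
    finally have "norm (integral {a..b} (w \<epsilon>) - integral {a..b} (j \<epsilon>)) / (2 * \<bar>\<epsilon>\<bar>)
        \<le> (D * \<bar>\<epsilon>\<bar> powr \<theta>) * (b - a) / (2 * \<bar>\<epsilon>\<bar>)"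
      by (rule divide_right_mono) simp
    also have "\<dots> = D * (b - a) / 2 * \<bar>\<epsilon>\<bar> powr (\<theta> - 1)"
      using elim by (simp add: powr_diff)
    finally show ?case by (simp flip: scaleR_diff_right)
  qed
  ultimately have "((\<lambda>\<epsilon>. (1 / (2 * \<epsilon>)) *\<^sub>R integral {a..b} (w \<epsilon>) - (1 / (2 * \<epsilon>)) *\<^sub>R integral {a..b} (j \<epsilon>)) \<longlongrightarrow> 0) (at 0)"
    by (rule Lim_null_comparison[rotated])
  from tendsto_add[OF this main]
  have "((\<lambda>\<epsilon>. (1 / (2 * \<epsilon>)) *\<^sub>R integral {a..b} (w \<epsilon>)) \<longlongrightarrow> J b - J a) (at 0)" by simp
  moreover have "\<forall>\<^sub>F \<epsilon> in at 0. w \<epsilon> integrable_on {a..b}"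
    using ev by eventually_elim (auto intro: integrable_continuous_real cw)
  ultimately show ?thesis unfolding has_symmetric_integral_def w_def by blast
qed

section \<open>Hoelder estimates from finite seminorms\<close>

lemma SUP_ennreal_bounded:
  assumes "(SUP z\<in>S. ennreal (f z)) < \<infinity>"
  shows "\<exists>C\<ge>0. \<forall>z\<in>S. f z \<le> C"
proof (intro exI conjI ballI)
  show "f z \<le> enn2real (SUP z\<in>S. ennreal (f z))" if "z \<in> S" for z
  proof -
    have "ennreal (f z) \<le> (SUP z\<in>S. ennreal (f z))" using that by (rule SUP_upper)
    also have "\<dots> = ennreal (enn2real (SUP z\<in>S. ennreal (f z)))" using assms by simp
    finally show ?thesis by simp
  qed
qed simp

text \<open>Clearing the denominator extends the estimate to the diagonal, where both sides vanish,
  and symmetry removes the restriction \<open>s < t\<close>.\<close>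

lemma holder_seminorm_bound:
  assumes "holder_seminorm \<gamma> a b \<phi> < \<infinity>"
  obtains H where "0 \<le> H"
    "\<And>s t. s \<in> {a..b} \<Longrightarrow> t \<in> {a..b} \<Longrightarrow> norm (\<phi> t - \<phi> s) \<le> H * \<bar>t - s\<bar> powr \<gamma>"
proof -
  let ?f = "\<lambda>(s, t). norm (\<phi> t - \<phi> s) / \<bar>t - s\<bar> powr \<gamma>"
  let ?S = "{(s, t). a \<le> s \<and> s < t \<and> t \<le> b}"
  have fin: "(SUP z\<in>?S. ennreal (?f z)) < \<infinity>"
    using assms unfolding holder_seminorm_def case_prod_beta .
  obtain H where H: "0 \<le> H" "\<And>z. z \<in> ?S \<Longrightarrow> ?f z \<le> H"
    using SUP_ennreal_bounded[OF fin] by blast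
  have lt: "norm (\<phi> t - \<phi> s) \<le> H * \<bar>t - s\<bar> powr \<gamma>" if "a \<le> s" "s < t" "t \<le> b" for s t
    using H(2)[of "(s, t)"] that by (simp add: divide_simps)
  show thesis
  proof (rule that[OF H(1)])
    fix s t assume "s \<in> {a..b}" "t \<in> {a..b}"
    then show "norm (\<phi> t - \<phi> s) \<le> H * \<bar>t - s\<bar> powr \<gamma>"
      using lt[of s t] lt[of t s] H(1)
      by (cases s t rule: linorder_cases) (auto simp: norm_minus_commute abs_minus_commute)
  qed
qed

lemma W_seminorm_bounds:
  assumes "W_seminorm \<beta> \<tau> lam a b W < \<infinity>"
  obtains C where "0 \<le> C"
    "\<And>s t x y. s \<in> {a..b} \<Longrightarrow> t \<in> {a..b} \<Longrightarrow> norm (W s x - W t x - W s y + W t y)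
      \<le> C * ((1 + norm x + norm y) powr \<beta> * \<bar>t - s\<bar> powr \<tau> * norm (x - y) powr lam)"
    "\<And>s t x. s \<in> {a..b} \<Longrightarrow> t \<in> {a..b} \<Longrightarrow> norm (W s x - W t x)
      \<le> C * ((1 + norm x) powr (\<beta> + lam) * \<bar>t - s\<bar> powr \<tau>)"
    "\<And>t x y. t \<in> {a..b} \<Longrightarrow> norm (W t y - W t x)
      \<le> C * ((1 + norm x + norm y) powr \<beta> * norm (x - y) powr lam)"
proof -
  let ?f1 = "\<lambda>(s, t, x, y). norm (W s x - W t x - W s y + W t y) /
      ((1 + norm x + norm y) powr \<beta> * \<bar>t - s\<bar> powr \<tau> * norm (x - y) powr lam)"
  let ?f2 = "\<lambda>(s, t, x). norm (W s x - W t x) / ((1 + norm x) powr (\<beta> + lam) * \<bar>t - s\<bar> powr \<tau>)"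
  let ?f3 = "\<lambda>(t, x, y). norm (W t y - W t x) / ((1 + norm x + norm y) powr \<beta> * norm (x - y) powr lam)"
  let ?S1 = "{(s, t, x::real^'a, y::real^'a). a \<le> s \<and> s < t \<and> t \<le> b \<and> x \<noteq> y}"
  let ?S2 = "{(s, t, x::real^'a). a \<le> s \<and> s < t \<and> t \<le> b}"
  let ?S3 = "{(t, x::real^'a, y::real^'a). a \<le> t \<and> t \<le> b \<and> x \<noteq> y}"
  have fin: "(SUP z\<in>?S1. ennreal (?f1 z)) < \<infinity>" "(SUP z\<in>?S2. ennreal (?f2 z)) < \<infinity>"
    "(SUP z\<in>?S3. ennreal (?f3 z)) < \<infinity>"
    using assms unfolding W_seminorm_def case_prod_beta by (auto simp: less_top)
  obtain C1 where C1: "0 \<le> C1" "\<And>z. z \<in> ?S1 \<Longrightarrow> ?f1 z \<le> C1"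
    using SUP_ennreal_bounded[OF fin(1)] by blast
  obtain C2 where C2: "0 \<le> C2" "\<And>z. z \<in> ?S2 \<Longrightarrow> ?f2 z \<le> C2"
    using SUP_ennreal_bounded[OF fin(2)] by blast
  obtain C3 where C3: "0 \<le> C3" "\<And>z. z \<in> ?S3 \<Longrightarrow> ?f3 z \<le> C3"
    using SUP_ennreal_bounded[OF fin(3)] by blast
  \<comment> \<open>Finiteness of the sum bounds each supremum separately; the maximum provides one
    constant for all three.\<close>
  define C where "C = max C1 (max C2 C3)"
  have C: "0 \<le> C" "C1 \<le> C" "C2 \<le> C" "C3 \<le> C" using C1(1) by (auto simp: C_def)
  have cross: "u \<le> C * d" if "u / d \<le> c" "c \<le> C" "0 < d" for u d c :: real
    using that by (simp add: pos_divide_le_eq) (meson mult_right_mono less_imp_le order_trans)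
  have pos: "0 < 1 + norm x" "0 < 1 + norm x + norm y" for x y :: "real^'a"
    by (smt (verit) norm_ge_zero)+
  have b1: "norm (W s x - W t x - W s y + W t y)
      \<le> C * ((1 + norm x + norm y) powr \<beta> * \<bar>t - s\<bar> powr \<tau> * norm (x - y) powr lam)"
    if "a \<le> s" "s < t" "t \<le> b" "x \<noteq> y" for s t x y
    using C1(2)[of "(s, t, x, y)"] C(2) pos(2)[of x y] that
    by (intro cross[where c = C1]) auto
  have b2: "norm (W s x - W t x) \<le> C * ((1 + norm x) powr (\<beta> + lam) * \<bar>t - s\<bar> powr \<tau>)"
    if "a \<le> s" "s < t" "t \<le> b" for s t x
    using C2(2)[of "(s, t, x)"] C(3) pos(1)[of x] that
    by (intro cross[where c = C2]) auto
  have b3: "norm (W t y - W t x) \<le> C * ((1 + norm x + norm y) powr \<beta> * norm (x - y) powr lam)"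
    if "a \<le> t" "t \<le> b" "x \<noteq> y" for t x y
    using C3(2)[of "(t, x, y)"] C(4) pos(2)[of x y] that
    by (intro cross[where c = C3]) auto
  show thesis
  proof (rule that[OF C(1)])
    fix s t x y assume "s \<in> {a..b}" "t \<in> {a..b}"
    \<comment> \<open>Exchanging the two times only changes the sign of the rectangular increment,
      so the case \<open>t < s\<close> follows from \<open>b1\<close>.\<close>
    moreover have "norm (W t x - W s x - W t y + W s y) = norm (W s x - W t x - W s y + W t y)"
      using norm_minus_cancel[of "W s x - W t x - W s y + W t y"] by (simp add: algebra_simps)
    ultimately show "norm (W s x - W t x - W s y + W t y)
      \<le> C * ((1 + norm x + norm y) powr \<beta> * \<bar>t - s\<bar> powr \<tau> * norm (x - y) powr lam)"
      using b1[of s t x y] b1[of t s x y] C(1)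
      by (cases "x = y"; cases s t rule: linorder_cases) (auto simp: abs_minus_commute)
  next
    fix s t x assume "s \<in> {a..b}" "t \<in> {a..b}"
    then show "norm (W s x - W t x) \<le> C * ((1 + norm x) powr (\<beta> + lam) * \<bar>t - s\<bar> powr \<tau>)"
      using b2[of s t x] b2[of t s x] C(1)
      by (cases s t rule: linorder_cases) (auto simp: abs_minus_commute norm_minus_commute)
  next
    fix t x y assume "t \<in> {a..b}"
    then show "norm (W t y - W t x) \<le> C * ((1 + norm x + norm y) powr \<beta> * norm (x - y) powr lam)"
      using b3[of t x y] C(1) by (cases "x = y") auto
  qed
qed

lemma continuous_on_of_holder:
  fixes f :: "real \<Rightarrow> 'v::real_normed_vector"
  assumes "0 < \<alpha>"
    and "\<And>s t. s \<in> S \<Longrightarrow> t \<in> S \<Longrightarrow> norm (f t - f s) \<le> H * \<bar>t - s\<bar> powr \<alpha>"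
  shows "continuous_on S f"
  unfolding continuous_on_def
proof
  fix s assume "s \<in> S"
  have "((\<lambda>t. H * \<bar>t - s\<bar> powr \<alpha>) \<longlongrightarrow> H * \<bar>s - s\<bar> powr \<alpha>) (at s within S)"
    using \<open>0 < \<alpha>\<close> by (intro tendsto_intros tendsto_powr') auto
  then have "((\<lambda>t. H * \<bar>t - s\<bar> powr \<alpha>) \<longlongrightarrow> 0) (at s within S)" by simp
  moreover have "\<forall>\<^sub>F t in at s within S. norm (f t - f s) \<le> H * \<bar>t - s\<bar> powr \<alpha>"
    using assms(2) \<open>s \<in> S\<close> by (auto simp: eventually_at_filter)
  ultimately have "((\<lambda>t. f t - f s) \<longlongrightarrow> 0) (at s within S)"
    by (rule Lim_null_comparison[rotated])
  then show "(f \<longlongrightarrow> f s) (at s within S)" by (rule LIM_zero_cancel)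
qed

text \<open>A Hoelder path is bounded on a compact interval, so the polynomial weights are absorbed
  into the constant, and \<open>norm (\<phi> p - \<phi> q) powr lam\<close> yields the exponent
  \<open>lam * \<gamma>\<close>. Times of \<open>W\<close> and parameters of \<open>\<phi>\<close>
  stay independent, as is required for evaluating
  \<open>W (s + \<epsilon>) (\<phi> s)\<close>.\<close>

lemma composed_bounds:
  fixes W :: "real \<Rightarrow> real ^ 'd \<Rightarrow> real ^ 'd"
  assumes "0 < lam" "0 \<le> \<beta>" "0 < \<gamma>"
    and W: "W_seminorm \<beta> \<tau> lam a b W < \<infinity>" and \<phi>: "holder_seminorm \<gamma> a b \<phi> < \<infinity>"
  shows "\<exists>C\<ge>0.
    (\<forall>s\<in>{a..b}. \<forall>t\<in>{a..b}. \<forall>p\<in>{a..b}. \<forall>q\<in>{a..b}. norm (W s (\<phi> p) - W t (\<phi> p) - W s (\<phi> q) + W t (\<phi> q))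
      \<le> C * (\<bar>t - s\<bar> powr \<tau> * \<bar>q - p\<bar> powr (lam * \<gamma>))) \<and>
    (\<forall>s\<in>{a..b}. \<forall>t\<in>{a..b}. \<forall>p\<in>{a..b}. norm (W t (\<phi> p) - W s (\<phi> p)) \<le> C * \<bar>t - s\<bar> powr \<tau>) \<and>
    (\<forall>t\<in>{a..b}. \<forall>p\<in>{a..b}. \<forall>q\<in>{a..b}. norm (W t (\<phi> q) - W t (\<phi> p)) \<le> C * \<bar>q - p\<bar> powr (lam * \<gamma>))"
proof -
  obtain C where C: "0 \<le> C"
    "\<And>s t x y. s \<in> {a..b} \<Longrightarrow> t \<in> {a..b} \<Longrightarrow> norm (W s x - W t x - W s y + W t y)
      \<le> C * ((1 + norm x + norm y) powr \<beta> * \<bar>t - s\<bar> powr \<tau> * norm (x - y) powr lam)"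
    "\<And>s t x. s \<in> {a..b} \<Longrightarrow> t \<in> {a..b} \<Longrightarrow> norm (W s x - W t x)
      \<le> C * ((1 + norm x) powr (\<beta> + lam) * \<bar>t - s\<bar> powr \<tau>)"
    "\<And>t x y. t \<in> {a..b} \<Longrightarrow> norm (W t y - W t x)
      \<le> C * ((1 + norm x + norm y) powr \<beta> * norm (x - y) powr lam)"
    by (rule W_seminorm_bounds[OF W]) (rule that, assumption, blast+)
  obtain H where H: "0 \<le> H"
    "\<And>s t. s \<in> {a..b} \<Longrightarrow> t \<in> {a..b} \<Longrightarrow> norm (\<phi> t - \<phi> s) \<le> H * \<bar>t - s\<bar> powr \<gamma>"
    by (rule holder_seminorm_bound[OF \<phi>]) (rule that, assumption, blast+)
  have "continuous_on {a..b} \<phi>" by (rule continuous_on_of_holder[OF \<open>0 < \<gamma>\<close> H(2)])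
  then have "bounded (\<phi> ` {a..b})"
    by (intro compact_imp_bounded compact_continuous_image compact_Icc)
  then obtain M where M: "\<And>p. p \<in> {a..b} \<Longrightarrow> norm (\<phi> p) \<le> M"
    unfolding bounded_iff by blast
  \<comment> \<open>The factor 2 serves the weights with two space points; the absolute value avoids
    any sign information on \<open>M\<close>.\<close>
  define R where "R = 1 + 2 * \<bar>M\<bar>"
  have R1: "(1 + norm (\<phi> p)) powr (\<beta> + lam) \<le> R powr (\<beta> + lam)" if "p \<in> {a..b}" for p
    using M[of p] that assms unfolding R_def by (intro powr_mono2) auto
  have R2: "(1 + norm (\<phi> p) + norm (\<phi> q)) powr \<beta> \<le> R powr \<beta>" if "p \<in> {a..b}" "q \<in> {a..b}" for p q
    using M[of p] M[of q] that assms
    unfolding R_def by (intro powr_mono2) auto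
  have \<phi>l: "norm (\<phi> p - \<phi> q) powr lam \<le> H powr lam * \<bar>q - p\<bar> powr (lam * \<gamma>)"
    if "p \<in> {a..b}" "q \<in> {a..b}" for p q
  proof -
    have "norm (\<phi> p - \<phi> q) powr lam \<le> (H * \<bar>q - p\<bar> powr \<gamma>) powr lam"
      using H(2)[OF that] \<open>0 < lam\<close> by (intro powr_mono2) (auto simp: norm_minus_commute)
    then show ?thesis using H(1) by (simp add: powr_mult powr_powr mult.commute)
  qed
  \<comment> \<open>The first summand serves the pure time increments, the second the two estimates
    comparing \<open>\<phi> p\<close> with \<open>\<phi> q\<close>.\<close>
  define D where "D = C * (R powr (\<beta> + lam) + R powr \<beta> * H powr lam)"
  have D0: "0 \<le> D" using C(1) by (simp add: D_def)
  have CD: "C * R powr (\<beta> + lam) \<le> D" "C * (R powr \<beta> * H powr lam) \<le> D"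
    using C(1) unfolding D_def by (auto intro!: mult_left_mono)
  show ?thesis
  proof (intro exI[of _ D] conjI ballI D0)
    fix s t p q assume *: "s \<in> {a..b}" "t \<in> {a..b}" "p \<in> {a..b}" "q \<in> {a..b}"
    have "norm (W s (\<phi> p) - W t (\<phi> p) - W s (\<phi> q) + W t (\<phi> q))
      \<le> C * ((1 + norm (\<phi> p) + norm (\<phi> q)) powr \<beta> * \<bar>t - s\<bar> powr \<tau> * norm (\<phi> p - \<phi> q) powr lam)"
      using * by (intro C(2)) auto
    also have "\<dots> \<le> C * (R powr \<beta> * \<bar>t - s\<bar> powr \<tau> * (H powr lam * \<bar>q - p\<bar> powr (lam * \<gamma>)))"
      using * C(1) by (intro mult_left_mono mult_mono R2 \<phi>l) auto
    also have "\<dots> = C * (R powr \<beta> * H powr lam) * (\<bar>t - s\<bar> powr \<tau> * \<bar>q - p\<bar> powr (lam * \<gamma>))" by simp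
    also have "\<dots> \<le> D * (\<bar>t - s\<bar> powr \<tau> * \<bar>q - p\<bar> powr (lam * \<gamma>))"
      by (intro mult_right_mono CD) simp
    finally show "norm (W s (\<phi> p) - W t (\<phi> p) - W s (\<phi> q) + W t (\<phi> q))
      \<le> D * (\<bar>t - s\<bar> powr \<tau> * \<bar>q - p\<bar> powr (lam * \<gamma>))" .
  next
    fix s t p assume *: "s \<in> {a..b}" "t \<in> {a..b}" "p \<in> {a..b}"
    have "norm (W t (\<phi> p) - W s (\<phi> p)) \<le> C * ((1 + norm (\<phi> p)) powr (\<beta> + lam) * \<bar>t - s\<bar> powr \<tau>)"
      using * C(3)[of s t "\<phi> p"] by (simp add: norm_minus_commute)
    also have "\<dots> \<le> C * (R powr (\<beta> + lam) * \<bar>t - s\<bar> powr \<tau>)"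
      using * C(1) by (intro mult_left_mono mult_right_mono R1) auto
    also have "\<dots> \<le> D * \<bar>t - s\<bar> powr \<tau>"
      unfolding mult.assoc[symmetric] by (intro mult_right_mono CD) simp
    finally show "norm (W t (\<phi> p) - W s (\<phi> p)) \<le> D * \<bar>t - s\<bar> powr \<tau>" .
  next
    fix t p q assume *: "t \<in> {a..b}" "p \<in> {a..b}" "q \<in> {a..b}"
    have "norm (W t (\<phi> q) - W t (\<phi> p))
      \<le> C * ((1 + norm (\<phi> p) + norm (\<phi> q)) powr \<beta> * norm (\<phi> p - \<phi> q) powr lam)"
      using * by (intro C(4)) auto
    also have "\<dots> \<le> C * (R powr \<beta> * (H powr lam * \<bar>q - p\<bar> powr (lam * \<gamma>)))"
      using * C(1) by (intro mult_left_mono mult_mono R2 \<phi>l) auto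
    also have "\<dots> = C * (R powr \<beta> * H powr lam) * \<bar>q - p\<bar> powr (lam * \<gamma>)" by simp
    also have "\<dots> \<le> D * \<bar>q - p\<bar> powr (lam * \<gamma>)"
      by (intro mult_right_mono CD) simp
    finally show "norm (W t (\<phi> q) - W t (\<phi> p)) \<le> D * \<bar>q - p\<bar> powr (lam * \<gamma>)" .
  qed
qed

section \<open>Sewing along the path and identification of the two integrals\<close>

theorem propositionA9:
  fixes W :: "real \<Rightarrow> real ^ 'd \<Rightarrow> real ^ 'd"
    and \<phi> :: "real \<Rightarrow> real ^ 'd"
    and \<tau> lam \<beta> \<gamma> T :: real
  assumes "0 < \<tau>" "\<tau> \<le> 1" "0 < lam" "lam \<le> 1" "0 \<le> \<beta>"
    and "\<And>a b. a < b \<Longrightarrow> W_seminorm \<beta> \<tau> lam a b W < \<infinity>"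
    and "0 < \<gamma>" "\<gamma> \<le> 1"
    and "\<And>a b. a < b \<Longrightarrow> holder_seminorm \<gamma> a b \<phi> < \<infinity>"
    and "\<tau> + lam * \<gamma> > 1"
    and "T > 0"
  shows "symmetric_integrable W \<phi> 0 T \<and> young_integrable W \<phi> 0 T \<and>
         symmetric_integral W \<phi> 0 T = young_integral W \<phi> 0 T"
proof -
  define \<theta> where "\<theta> = \<tau> + lam * \<gamma>"
  have "1 < \<theta>" using assms by (simp add: \<theta>_def)
  have "0 < lam * \<gamma>" using assms by simp
  \<comment> \<open>One unit of room on each side keeps \<open>s + \<epsilon>\<close> and
    \<open>s - \<epsilon>\<close> in \<open>I\<close> for \<open>s\<close> in \<open>{0..T}\<close>
    and \<open>\<bar>\<epsilon>\<bar> < 1\<close>.\<close>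
  define I where "I = {-1..T + 1}"
  have fin: "W_seminorm \<beta> \<tau> lam (-1) (T + 1) W < \<infinity>" "holder_seminorm \<gamma> (-1) (T + 1) \<phi> < \<infinity>"
    by (intro assms(6,9); use assms(11) in simp)+
  obtain C where C0: "0 \<le> C"
    "\<forall>s\<in>I. \<forall>t\<in>I. \<forall>p\<in>I. \<forall>q\<in>I. norm (W s (\<phi> p) - W t (\<phi> p) - W s (\<phi> q) + W t (\<phi> q))
      \<le> C * (\<bar>t - s\<bar> powr \<tau> * \<bar>q - p\<bar> powr (lam * \<gamma>))"
    "\<forall>s\<in>I. \<forall>t\<in>I. \<forall>p\<in>I. norm (W t (\<phi> p) - W s (\<phi> p)) \<le> C * \<bar>t - s\<bar> powr \<tau>"
    "\<forall>t\<in>I. \<forall>p\<in>I. \<forall>q\<in>I. norm (W t (\<phi> q) - W t (\<phi> p)) \<le> C * \<bar>q - p\<bar> powr (lam * \<gamma>)"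
    using composed_bounds[OF assms(3,5,7) fin, folded I_def] by blast
  note C = C0(1) C0(2-4)[rule_format]
  define A where "A = (\<lambda>s t. W t (\<phi> s) - W s (\<phi> s))"
  have delta: "norm (A s t - A s u - A u t) \<le> C * (t - s) powr \<theta>"
    if "-1 \<le> s" "s \<le> u" "u \<le> t" "t \<le> T + 1" for s u t
  proof -
    \<comment> \<open>The terms at time \<open>s\<close> cancel. What remains is a rectangular
      increment between times \<open>u\<close>, \<open>t\<close> and points \<open>\<phi> s\<close>,
      \<open>\<phi> u\<close>, so the exponents \<open>\<tau>\<close> and
      \<open>lam * \<gamma>\<close> add up to \<open>\<theta>\<close>.\<close>
    have "A s t - A s u - A u t = W t (\<phi> s) - W u (\<phi> s) - W t (\<phi> u) + W u (\<phi> u)"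
      by (simp add: A_def)
    also have "norm \<dots> \<le> C * (\<bar>u - t\<bar> powr \<tau> * \<bar>u - s\<bar> powr (lam * \<gamma>))"
      using that by (intro C(2)) (auto simp: I_def)
    also have "\<dots> \<le> C * ((t - s) powr \<tau> * (t - s) powr (lam * \<gamma>))"
      using that C(1) assms by (intro mult_left_mono mult_mono powr_mono2) auto
    finally show ?thesis by (simp add: \<theta>_def powr_add)
  qed
  have "-1 \<le> T + 1" using assms by simp
  obtain J K where K: "0 \<le> K" and J0: "\<forall>s t. -1 \<le> s \<longrightarrow> s \<le> t \<longrightarrow> t \<le> T + 1 \<longrightarrow>
      norm (J t - J s - A s t) \<le> K * (t - s) powr \<theta>"
    using sewing[OF \<open>1 < \<theta>\<close> C(1) \<open>-1 \<le> T + 1\<close> delta] by blast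
  note J = J0[rule_format]

  have young: "has_young_integral W \<phi> 0 T (J T - J 0)"
    using J assms unfolding A_def
    by (intro has_young_integral_of_sewing[OF \<open>1 < \<theta>\<close> K]) auto

  have Jcont: "continuous_on I J"
  proof (rule continuous_on_of_holder[OF \<open>0 < \<tau>\<close>])
    \<comment> \<open>The first term bounds \<open>A\<close>; in the sewing error a factor
      \<open>(t - s) powr (lam * \<gamma>)\<close> is split off and bounded through the length
      \<open>T + 2\<close> of \<open>I\<close>.\<close>
    define H where "H = C + K * (T + 2) powr (lam * \<gamma>)"
    have le: "norm (J t - J s) \<le> H * (t - s) powr \<tau>" if "-1 \<le> s" "s \<le> t" "t \<le> T + 1" for s t
    proof -
      have "norm (J t - J s) \<le> norm (A s t) + norm (J t - J s - A s t)"
        using norm_triangle_ineq[of "A s t" "J t - J s - A s t"] by simp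
      also have "norm (A s t) \<le> C * (t - s) powr \<tau>"
        using C(3)[of s t s] that by (simp add: A_def I_def)
      also have "norm (J t - J s - A s t) \<le> K * ((t - s) powr \<tau> * (t - s) powr (lam * \<gamma>))"
        using J[OF that] by (simp add: \<theta>_def powr_add)
      also have "\<dots> \<le> K * ((t - s) powr \<tau> * (T + 2) powr (lam * \<gamma>))"
        using that K \<open>0 < lam * \<gamma>\<close> by (intro mult_left_mono powr_mono2) auto
      finally show ?thesis by (simp add: H_def algebra_simps)
    qed
    fix s t assume "s \<in> I" "t \<in> I"
    then show "norm (J t - J s) \<le> H * \<bar>t - s\<bar> powr \<tau>"
      using le[of s t] le[of t s] by (cases "s \<le> t") (auto simp: I_def norm_minus_commute)
  qed

  have "has_symmetric_integral W \<phi> 0 T (J T - J 0)"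
  proof (rule has_symmetric_integral_of_approx[OF \<open>1 < \<theta>\<close>])
    show "continuous_on {0 - 1..T + 1} J" using Jcont by (simp add: I_def)
  next
    fix \<epsilon> :: real assume \<epsilon>: "\<bar>\<epsilon>\<bar> < 1"
    have in_I: "s + \<epsilon> \<in> I" "s \<in> I" if "s \<in> {0..T}" for s using that \<epsilon> by (auto simp: I_def)
    have c1: "continuous_on {0..T} (\<lambda>s. W (s + \<epsilon>) (\<phi> p))" if "p \<in> I" for p
    proof (rule continuous_on_of_holder[OF \<open>0 < \<tau>\<close>])
      fix s t assume "s \<in> {0..T}" "t \<in> {0..T}"
      then show "norm (W (t + \<epsilon>) (\<phi> p) - W (s + \<epsilon>) (\<phi> p)) \<le> C * \<bar>t - s\<bar> powr \<tau>"
        using C(3)[OF in_I(1) in_I(1) that, of s t] by simp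
    qed
    show "continuous_on {0..T} (\<lambda>s. W (s + \<epsilon>) (\<phi> s))"
      unfolding continuous_on_def
    proof
      fix s assume s: "s \<in> {0..T}"
      have "((\<lambda>t. C * \<bar>t - s\<bar> powr (lam * \<gamma>)) \<longlongrightarrow> C * \<bar>s - s\<bar> powr (lam * \<gamma>)) (at s within {0..T})"
        using \<open>0 < lam * \<gamma>\<close> by (intro tendsto_intros tendsto_powr') auto
      then have "((\<lambda>t. C * \<bar>t - s\<bar> powr (lam * \<gamma>)) \<longlongrightarrow> 0) (at s within {0..T})" by simp
      moreover have "\<forall>\<^sub>F t in at s within {0..T}.
          norm (W (t + \<epsilon>) (\<phi> t) - W (t + \<epsilon>) (\<phi> s)) \<le> C * \<bar>t - s\<bar> powr (lam * \<gamma>)"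
        unfolding eventually_at_filter
        by (intro always_eventually allI impI C(4) in_I s)
      ultimately have "((\<lambda>t. W (t + \<epsilon>) (\<phi> t) - W (t + \<epsilon>) (\<phi> s)) \<longlongrightarrow> 0) (at s within {0..T})"
        by (rule Lim_null_comparison[rotated])
      moreover have "((\<lambda>t. W (t + \<epsilon>) (\<phi> s)) \<longlongrightarrow> W (s + \<epsilon>) (\<phi> s)) (at s within {0..T})"
        using c1[OF in_I(2)[OF s]] s by (simp add: continuous_on_def)
      ultimately have "((\<lambda>t. (W (t + \<epsilon>) (\<phi> t) - W (t + \<epsilon>) (\<phi> s)) + W (t + \<epsilon>) (\<phi> s))
          \<longlongrightarrow> 0 + W (s + \<epsilon>) (\<phi> s)) (at s within {0..T})"
        by (rule tendsto_add)
      then show "((\<lambda>t. W (t + \<epsilon>) (\<phi> t)) \<longlongrightarrow> W (s + \<epsilon>) (\<phi> s)) (at s within {0..T})"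
        by simp
    qed
  next
    fix \<epsilon> s :: real assume *: "0 < \<epsilon>" "\<epsilon> < 1" "s \<in> {0..T}"
    \<comment> \<open>The forward half of the symmetric increment is exactly
      \<open>A s (s + \<epsilon>)\<close>. The backward half evaluates at \<open>\<phi> s\<close>,
      whereas \<open>A (s - \<epsilon>) s\<close> uses \<open>\<phi> (s - \<epsilon>)\<close>;
      \<open>?R\<close> is the correction for this change of base point.\<close>
    let ?R = "W (s - \<epsilon>) (\<phi> (s - \<epsilon>)) - W s (\<phi> (s - \<epsilon>)) - W (s - \<epsilon>) (\<phi> s) + W s (\<phi> s)"
    have "norm (J (s + \<epsilon>) - J s - A s (s + \<epsilon>)) \<le> K * \<epsilon> powr \<theta>"
      using J[of s "s + \<epsilon>"] * by simp
    moreover have "norm (J s - J (s - \<epsilon>) - A (s - \<epsilon>) s) \<le> K * \<epsilon> powr \<theta>"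
      using J[of "s - \<epsilon>" s] * by simp
    moreover have "norm ?R \<le> C * \<epsilon> powr \<theta>"
      using C(2)[of "s - \<epsilon>" s "s - \<epsilon>" s] * by (simp add: I_def \<theta>_def powr_add)
    moreover have "W (s + \<epsilon>) (\<phi> s) - W (s - \<epsilon>) (\<phi> s) - (J (s + \<epsilon>) - J (s - \<epsilon>)) =
      ?R - (J (s + \<epsilon>) - J s - A s (s + \<epsilon>)) - (J s - J (s - \<epsilon>) - A (s - \<epsilon>) s)"
      by (simp add: A_def algebra_simps)
    ultimately have "norm (W (s + \<epsilon>) (\<phi> s) - W (s - \<epsilon>) (\<phi> s) - (J (s + \<epsilon>) - J (s - \<epsilon>)))
       \<le> C * \<epsilon> powr \<theta> + K * \<epsilon> powr \<theta> + K * \<epsilon> powr \<theta>"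
      by (smt (verit) norm_triangle_ineq4)
    then show "norm (W (s + \<epsilon>) (\<phi> s) - W (s - \<epsilon>) (\<phi> s) - (J (s + \<epsilon>) - J (s - \<epsilon>)))
       \<le> (C + 2 * K) * \<epsilon> powr \<theta>"
      by (simp add: algebra_simps)
  qed (use assms in simp)
  \<comment> \<open>Uniqueness of both limits identifies each \<open>THE\<close> term with
    \<open>J T - J 0\<close>.\<close>
  with young show ?thesis
    using has_young_integral_unique[OF \<open>T > 0\<close>] has_symmetric_integral_unique
    unfolding symmetric_integrable_def young_integrable_def symmetric_integral_def young_integral_def
    by (smt (verit, best) the_equality)
qed

end
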